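(* There is a (concrete) family $\big((\mathbb{K}_\alpha,\mathbb{G}_\alpha)\big)_{\alpha\in 2^\omega}$, where each $\mathbb{K}_\alpha$ is a compact subset of $2^\omega$ and each $\mathbb{G}_\alpha$ is a countable graph on $\mathbb{K}_\alpha$, such that, for any 0DMC space $X$ and any graph $G$ on $X$, exactly one of the following holds: (1) $(X,G)$ has CCN at most two; (2) there are $\alpha\in 2^\omega$ and an injective continuous map $\varphi:\mathbb{K}_\alpha\to X$ such that $\mathbb{G}_\alpha\subseteq(\varphi\times\varphi)^{-1}(G)$. In other words, $\big((\mathbb{K}_\alpha,\mathbb{G}_\alpha)\big)_{\alpha\in 2^\omega}$ is a $\preceq^i_c$-basis (and thus a $\preceq_c$-basis) for $\mathfrak{K}$. Concretely, this family can be taken to be the family $\big((\mathbb{K}_\gamma,\mathbb{G}_\gamma)\big)_{\gamma\in\mathcal{I}}$ defined in the context, re-indexed by $2^\omega$.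
   Context: A space is 0DMC if it is zero-dimensional (has a basis of clopen sets), metrizable and compact. A digraph on $X$ is a binary relation $R\subseteq X^2$ disjoint from the diagonal $\Delta(X)=\{(x,x)\mid x\in X\}$; a graph is a symmetric digraph. A coloring of $R$ is a map $c$ on $X$ with $c(x)\neq c(y)$ whenever $(x,y)\in R$. The continuous chromatic number (CCN) $\chi_c(X,R)$ is the least cardinal $\kappa\leq\aleph_0$ for which there is a continuous coloring $c:X\to\kappa$ of $R$ ($\kappa$ discrete) if it exists, and $2^{\aleph_0}$ otherwise. We write $(X,R)\preceq_c(Y,S)$ if there is a continuous $\varphi:X\to Y$ with $R\subseteq(\varphi\times\varphi)^{-1}(S)$, and $(X,R)\preceq^i_c(Y,S)$ if moreover $\varphi$ can be chosen injective. $\mathfrak{K}$ is the class of graphs on a 0DMC space with CCN at least three (pairs $(X,G)$). A subclass $\mathfrak{B}$ of a class $\Gamma$ is a $\leq$-basis for $\Gamma$ if every element of $\Gamma$ is $\leq$-above some element of $\mathfrak{B}$. Concrete family. For a relation $R$, $s(R)=R\cup R^{-1}$, and $\mathrm{proj}[R]$ is the projection of $R$ on the first coordinate. Let $\mathcal{S}$ be the set of $\delta\in\omega^\omega$ that are nondecreasing ($\delta(k)\leq\delta(k+1)$ for all $k$) and unbounded. Let $\mathcal{I}$ be the set of all $\gamma=\Big(\big((\gamma^0_k(i))_{i\leq 2k},(\gamma^1_k(i))_{i\leq 2k}\big)\Big)_{k\in\omega}\in\prod_{k\in\omega}(2^\omega)^{2k+1}\times(2^\omega)^{2k+1}$ such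 that: $\gamma^0_k(0)\to 0^\infty$ and $\gamma^1_k(2k)\to 0^\infty$ as $k\to\infty$; $\gamma^0_k(i)\neq\gamma^1_k(i)$ for all $k\in\omega$, $i\leq 2k$; and there is $\delta\in\mathcal{S}$ such that, for all $k\in\omega$ and $i<2k$, the restrictions satisfy $\gamma^1_k(i)|\delta(k)=\gamma^0_k(i+1)|\delta(k)$. For $\gamma\in\mathcal{I}$, $\mathbb{G}_\gamma=s\big(\{(\gamma^0_k(i),\gamma^1_k(i))\mid k\in\omega,\ i\leq 2k\}\big)$ and $\mathbb{K}_\gamma$ is the closure of $\mathrm{proj}[\mathbb{G}_\gamma]$ in $2^\omega$. *)

theory Defs
  imports "HOL-Analysis.Analysis" "HOL-Library.Extended_Nat"
begin

section \<open>Zero-dimensional metrizable compact spaces, digraphs and graphs\<close>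

definition zero_dimensional_space :: "'a topology \<Rightarrow> bool" where
  "zero_dimensional_space X \<longleftrightarrow>
     (\<exists>\<B>. (\<forall>U\<in>\<B>. openin X U \<and> closedin X U) \<and>
          openin X = arbitrary union_of (\<lambda>U. U \<in> \<B>))"

definition zero_DMC :: "'a topology \<Rightarrow> bool" where
  "zero_DMC X \<longleftrightarrow> zero_dimensional_space X \<and> metrizable_space X \<and> compact_space X"

definition digraph_on :: "'a set \<Rightarrow> ('a \<times> 'a) set \<Rightarrow> bool" where
  "digraph_on A R \<longleftrightarrow> R \<subseteq> A \<times> A \<and> R \<inter> Id = {}"

definition graph_on :: "'a set \<Rightarrow> ('a \<times> 'a) set \<Rightarrow> bool" where
  "graph_on A R \<longleftrightarrow> digraph_on A R \<and> sym R"

section \<open>Continuous chromatic number\<close>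

text \<open>The cardinals that occur as values: those at most \<open>\<aleph>\<^sub>0\<close>, represented by \<^typ>\<open>enat\<close>
  (with \<open>\<infinity>\<close> for \<open>\<aleph>\<^sub>0\<close>), and \<open>2\<close> to the power \<open>\<aleph>\<^sub>0\<close>.\<close>

datatype ccn_value = Countable_card enat | Continuum

instantiation ccn_value :: linorder
begin

fun less_eq_ccn_value :: "ccn_value \<Rightarrow> ccn_value \<Rightarrow> bool" where
  "Countable_card m \<le> Countable_card n \<longleftrightarrow> m \<le> n"
| "x \<le> Continuum \<longleftrightarrow> True"
| "Continuum \<le> Countable_card n \<longleftrightarrow> False"

definition less_ccn_value :: "ccn_value \<Rightarrow> ccn_value \<Rightarrow> bool" where
  "x < y \<longleftrightarrow> x \<le> y \<and> \<not> y \<le> (x :: ccn_value)"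

instance
proof
  fix x y z :: ccn_value
  show "x < y \<longleftrightarrow> x \<le> y \<and> \<not> y \<le> x" by (rule less_ccn_value_def)
  show "x \<le> x" by (cases x) auto
  show "x \<le> y \<Longrightarrow> y \<le> z \<Longrightarrow> x \<le> z" by (cases x; cases y; cases z) auto
  show "x \<le> y \<Longrightarrow> y \<le> x \<Longrightarrow> x = y" by (cases x; cases y) auto
  show "x \<le> y \<or> y \<le> x" by (cases x; cases y) auto
qed

end

text \<open>As usual, a cardinal \<open>\<kappa> \<le> \<aleph>\<^sub>0\<close> is identified with the set of natural numbers below it.\<close>

definition has_continuous_coloring :: "'a topology \<Rightarrow> ('a \<times> 'a) set \<Rightarrow> enat \<Rightarrow> bool" where
  "has_continuous_coloring X R \<kappa> \<longleftrightarrow>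
     (\<exists>c. continuous_map X (discrete_topology {i :: nat. enat i < \<kappa>}) c \<and>
          (\<forall>(x, y)\<in>R. c x \<noteq> c y))"

definition CCN :: "'a topology \<Rightarrow> ('a \<times> 'a) set \<Rightarrow> ccn_value" where
  "CCN X R =
     (if \<exists>\<kappa>. has_continuous_coloring X R \<kappa>
      then Countable_card (LEAST \<kappa>. has_continuous_coloring X R \<kappa>)
      else Continuum)"

section \<open>Quasi-orders and bases\<close>

definition le_c :: "'a topology \<times> ('a \<times> 'a) set \<Rightarrow> 'b topology \<times> ('b \<times> 'b) set \<Rightarrow> bool" where
  "le_c = (\<lambda>(X, R) (Y, S).
     \<exists>\<phi>. continuous_map X Y \<phi> \<and> R \<subseteq> map_prod \<phi> \<phi> -` S)"

definition le_c_inj :: "'a topology \<times> ('a \<times> 'a) set \<Rightarrow> 'b topology \<times> ('b \<times> 'b) set \<Rightarrow> bool" where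
  "le_c_inj = (\<lambda>(X, R) (Y, S).
     \<exists>\<phi>. continuous_map X Y \<phi> \<and> inj_on \<phi> (topspace X) \<and> R \<subseteq> map_prod \<phi> \<phi> -` S)"

definition frakK :: "('a topology \<times> ('a \<times> 'a) set) set" where
  "frakK = {(X, G). zero_DMC X \<and> graph_on (topspace X) G \<and> Countable_card 3 \<le> CCN X G}"

text \<open>A class of spaces is represented by its instances at the individual carrier types, and the
  elements of a basis may live on another type than the spaces they are compared with. Hence the
  class appears twice: \<open>\<Gamma>'\<close> is its instance at the type of the basis, \<open>\<Gamma>\<close> its instance at the type
  of the elements to be bounded from below.\<close>

definition is_basis :: "('b \<Rightarrow> 'a \<Rightarrow> bool) \<Rightarrow> 'b set \<Rightarrow> 'b set \<Rightarrow> 'a set \<Rightarrow> bool" where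
  "is_basis le B \<Gamma>' \<Gamma> \<longleftrightarrow> B \<subseteq> \<Gamma>' \<and> (\<forall>g\<in>\<Gamma>. \<exists>b\<in>B. le b g)"

section \<open>The concrete family\<close>

type_synonym cantor = "nat \<Rightarrow> bool"

definition cantor_space :: "cantor topology" where
  "cantor_space = product_topology (\<lambda>_. discrete_topology UNIV) UNIV"

definition zeros :: cantor where
  "zeros = (\<lambda>_. False)"

definition calS :: "(nat \<Rightarrow> nat) set" where
  "calS = {\<delta>. (\<forall>k. \<delta> k \<le> \<delta> (Suc k)) \<and> \<not> bdd_above (range \<delta>)}"

type_synonym gamma = "nat \<Rightarrow> (nat \<Rightarrow> cantor) \<times> (nat \<Rightarrow> cantor)"

text \<open>\<^term>\<open>fst (\<gamma> k) i\<close> and \<^term>\<open>snd (\<gamma> k) i\<close> are the points written with upper index \<open>0\<close> and \<open>1\<close>,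
  respectively, and lower index \<open>k\<close>. The extensional function spaces make \<open>calI\<close> a set of genuine
  elements of the product, without junk values at indices beyond \<open>2 * k\<close>.\<close>

definition calI :: "gamma set" where
  "calI = {\<gamma>. (\<forall>k. \<gamma> k \<in> ({..2 * k} \<rightarrow>\<^sub>E UNIV) \<times> ({..2 * k} \<rightarrow>\<^sub>E UNIV)) \<and>
     limitin cantor_space (\<lambda>k. fst (\<gamma> k) 0) zeros sequentially \<and>
     limitin cantor_space (\<lambda>k. snd (\<gamma> k) (2 * k)) zeros sequentially \<and>
     (\<forall>k. \<forall>i\<le>2 * k. fst (\<gamma> k) i \<noteq> snd (\<gamma> k) i) \<and>
     (\<exists>\<delta>\<in>calS. \<forall>k. \<forall>i<2 * k.
        restrict (snd (\<gamma> k) i) {..<\<delta> k} = restrict (fst (\<gamma> k) (Suc i)) {..<\<delta> k})}"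

definition symmetrization :: "('a \<times> 'a) set \<Rightarrow> ('a \<times> 'a) set" where
  "symmetrization R = R \<union> R\<inverse>"

definition bbG :: "gamma \<Rightarrow> (cantor \<times> cantor) set" where
  "bbG \<gamma> = symmetrization {(fst (\<gamma> k) i, snd (\<gamma> k) i) | k i. i \<le> 2 * k}"

definition bbK :: "gamma \<Rightarrow> cantor set" where
  "bbK \<gamma> = cantor_space closure_of (fst ` bbG \<gamma>)"

abbreviation bbK_space :: "gamma \<Rightarrow> cantor topology" where
  "bbK_space \<gamma> \<equiv> subtopology cantor_space (bbK \<gamma>)"

end

theory Submission
  imports Defs
begin

text \<open>
  A continuous coloring of a compact subset of the Cantor space depends on finitely many
  coordinates only. Hence a graph on such a set has CCN at most two iff, for some \<open>n\<close>, the relation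
  that it induces on the initial segments of length \<open>n\<close> has no closed walk of odd length. Pulled
  back to the graph, an odd closed walk of this quotient is a sequence of an odd number of edges in
  which the end of each edge agrees up to \<open>n\<close> with the start of the next one, cyclically. An
  element of \<open>calI\<close> is a sequence of such almost closed odd walks, one of each length \<open>2 * k + 1\<close>,
  with precision tending to infinity and both end points tending to \<open>zeros\<close>.

  That the graphs in the family have no continuous 2-coloring is then a matter of parity
  (\<open>calI_not_2colorable\<close>): by uniform continuity, the two ends of a walk of high index get the same
  color, whereas the color changes at each of its \<open>2 * k + 1\<close> edges and nowhere else.

  Conversely, let \<open>G\<close> be a graph on \<open>X\<close> without continuous 2-coloring. A countable family of clopen
  sets separating the points embeds \<open>X\<close> into the Cantor space. A proper 2-coloring of one of the
  finite quotients would induce a continuous one of \<open>G\<close>, so there are almost closed odd walks of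
  every precision \<open>n\<close> (\<open>not_2colorable_imp_odd_walk\<close>). By compactness their base points
  accumulate at some \<open>z\<close>
  (\<open>odd_walks_at_common_point\<close>), and the translation of \<open>2\<^sup>\<omega>\<close> that sends \<open>z\<close> to \<open>zeros\<close> moves
  it to the prescribed place. A walk can be lengthened by running back and forth along its last
  edge, so walks of precision tending to infinity can be chosen with exactly \<open>2 * k + 1\<close> edges
  for each \<open>k\<close> (\<open>calI_of_odd_walks\<close>). This yields \<open>\<gamma> \<in> calI\<close> with \<open>bbG \<gamma>\<close> contained in the copy of
  \<open>G\<close>. As that copy lives on a closed set, \<open>bbK \<gamma>\<close> is contained in the image of \<open>X\<close>, and the
  inverse of the embedding, restricted to \<open>bbK \<gamma>\<close>, is the required injection
  (\<open>calI_minorizes\<close>).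
\<close>

section \<open>The topology of the Cantor space\<close>

definition agree :: "nat \<Rightarrow> cantor \<Rightarrow> cantor \<Rightarrow> bool" where
  "agree n p q \<longleftrightarrow> (\<forall>i<n. p i = q i)"

lemma agree_refl [simp]: "agree n p p"
  by (simp add: agree_def)

lemma agree_sym: "agree n p q \<Longrightarrow> agree n q p"
  by (simp add: agree_def)

lemma agree_trans: "agree n p q \<Longrightarrow> agree n q r \<Longrightarrow> agree n p r"
  by (simp add: agree_def)

lemma agree_mono: "agree n p q \<Longrightarrow> m \<le> n \<Longrightarrow> agree m p q"
  by (simp add: agree_def)

lemma agree_iff_restrict: "restrict p {..<n} = restrict q {..<n} \<longleftrightarrow> agree n p q"
  by (auto simp: agree_def restrict_def fun_eq_iff)

lemma topspace_cantor [simp]: "topspace cantor_space = UNIV"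
  by (simp add: cantor_space_def)

lemma compact_space_cantor: "compact_space cantor_space"
  by (simp add: cantor_space_def compact_space_product_topology compact_space_discrete_topology)

lemma metrizable_space_cantor: "metrizable_space cantor_space"
  by (simp add: cantor_space_def metrizable_space_product_topology)

lemma Hausdorff_space_cantor: "Hausdorff_space cantor_space"
  by (simp add: metrizable_imp_Hausdorff_space metrizable_space_cantor)

lemma openin_cylinder: "openin cantor_space {q. agree n p q}"
proof (induction n)
  case 0
  then show ?case
    using openin_topspace[of cantor_space] by (simp add: agree_def)
next
  case (Suc n)
  have "continuous_map cantor_space (discrete_topology UNIV) (\<lambda>q. q n)"
    unfolding cantor_space_def by (rule continuous_map_product_projection) simp
  then have "openin cantor_space {q \<in> topspace cantor_space. q n \<in> {p n}}"
    by (rule openin_continuous_map_preimage) simp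
  moreover have "{q. agree (Suc n) p q} = {q. agree n p q} \<inter> {q \<in> topspace cantor_space. q n \<in> {p n}}"
    by (auto simp: agree_def less_Suc_eq)
  ultimately show ?case
    using Suc by (simp add: openin_Int)
qed

lemma openin_cantor_iff:
  "openin cantor_space U \<longleftrightarrow> (\<forall>p\<in>U. \<exists>n. {q. agree n p q} \<subseteq> U)"
proof
  assume U: "openin cantor_space U"
  show "\<forall>p\<in>U. \<exists>n. {q. agree n p q} \<subseteq> U"
  proof
    fix p assume "p \<in> U"
    with U obtain V where V: "finite {i. V i \<noteq> (UNIV :: bool set)}" "p \<in> Pi\<^sub>E UNIV V" "Pi\<^sub>E UNIV V \<subseteq> U"
      unfolding cantor_space_def openin_product_topology_alt by (auto simp: cantor_space_def)
    obtain n where n: "\<And>i. V i \<noteq> UNIV \<Longrightarrow> i < n"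
      using V(1) by (metis (mono_tags, lifting) finite_nat_set_iff_bounded mem_Collect_eq)
    have "{q. agree n p q} \<subseteq> Pi\<^sub>E UNIV V"
    proof
      fix q assume q: "q \<in> {q. agree n p q}"
      show "q \<in> Pi\<^sub>E UNIV V"
      proof (rule PiE_I)
        fix i show "q i \<in> V i"
        proof (cases "V i = UNIV")
          case False
          then have "q i = p i" using n q by (simp add: agree_def)
          then show ?thesis using V(2) by auto
        qed simp
      qed simp
    qed
    then show "\<exists>n. {q. agree n p q} \<subseteq> U" using V(3) by blast
  qed
next
  assume *: "\<forall>p\<in>U. \<exists>n. {q. agree n p q} \<subseteq> U"
  show "openin cantor_space U"
  proof (subst openin_subopen, intro ballI)
    fix p assume "p \<in> U"
    then obtain n where "{q. agree n p q} \<subseteq> U" using * by blast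
    then show "\<exists>T. openin cantor_space T \<and> p \<in> T \<and> T \<subseteq> U"
      using openin_cylinder[of n p] by (intro exI[of _ "{q. agree n p q}"]) auto
  qed
qed

lemma closedin_cylinder: "closedin cantor_space {q. agree n p q}"
proof -
  have "openin cantor_space (UNIV - {q. agree n p q})"
    unfolding openin_cantor_iff using agree_sym agree_trans by blast
  then show ?thesis by (simp add: closedin_def)
qed

lemma limitin_cantor_iff:
  "limitin cantor_space f z sequentially \<longleftrightarrow> (\<forall>n. \<forall>\<^sub>F k in sequentially. agree n z (f k))"
proof
  assume lim: "limitin cantor_space f z sequentially"
  have "\<forall>\<^sub>F k in sequentially. f k \<in> {q. agree n z q}" for n
    using lim openin_cylinder[of n z] unfolding limitin_def by (metis agree_refl mem_Collect_eq)
  then show "\<forall>n. \<forall>\<^sub>F k in sequentially. agree n z (f k)" by simp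
next
  assume *: "\<forall>n. \<forall>\<^sub>F k in sequentially. agree n z (f k)"
  show "limitin cantor_space f z sequentially"
    unfolding limitin_def
  proof (intro conjI allI impI)
    fix U assume "openin cantor_space U \<and> z \<in> U"
    then obtain n where n: "{q. agree n z q} \<subseteq> U" by (meson openin_cantor_iff)
    show "\<forall>\<^sub>F k in sequentially. f k \<in> U"
      using spec[OF *, of n] by eventually_elim (use n in auto)
  qed simp
qed

text \<open>Compactness of the Cantor space, in a form that avoids choosing sequences and subsequences: if
  each level \<open>n\<close> has a witness for \<open>Q\<close>, then witnesses of arbitrarily high levels accumulate at
  one point. Otherwise finitely many cylinders that contain witnesses of bounded level only would
  cover the space.\<close>

lemma cantor_cluster_point:
  assumes "\<And>n. \<exists>p. Q n p"
  shows "\<exists>z. \<forall>N. \<exists>n\<ge>N. \<exists>p. Q n p \<and> agree N z p"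
proof (rule ccontr)
  assume "\<not> ?thesis"
  then obtain N where N: "\<And>z n p. n \<ge> N z \<Longrightarrow> Q n p \<Longrightarrow> \<not> agree (N z) z p"
    by metis
  let ?C = "\<lambda>z. {q. agree (N z) z q}"
  have "compactin cantor_space UNIV"
    using compact_space_cantor by (simp add: compact_space_def)
  moreover have "openin cantor_space U" if "U \<in> range ?C" for U
    using that openin_cylinder by blast
  moreover have "UNIV \<subseteq> \<Union> (range ?C)"
    using agree_refl by blast
  ultimately have "\<exists>\<F>. finite \<F> \<and> \<F> \<subseteq> range ?C \<and> UNIV \<subseteq> \<Union> \<F>"
    by (rule compactinD)
  then obtain \<F> where "finite \<F>" "\<F> \<subseteq> range ?C" "UNIV \<subseteq> \<Union> \<F>"
    by blast
  then obtain F where F: "finite F" "UNIV \<subseteq> \<Union> (?C ` F)"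
    using finite_subset_image[of \<F> ?C UNIV] by blast
  define n where "n = Max (N ` F)"
  obtain p where p: "Q n p" using assms by blast
  obtain z where "z \<in> F" "agree (N z) z p" using F(2) by blast
  moreover have "N z \<le> n" using \<open>z \<in> F\<close> F(1) by (simp add: n_def)
  ultimately show False using N p by blast
qed

text \<open>Uniform continuity of continuous maps from a closed set to a discrete space: at a cluster point
  of pairs violating this at every \<open>n\<close>, which belongs to the closed set, the map would not be locally
  constant.\<close>

lemma uniform_agree_of_continuous:
  assumes K: "closedin cantor_space K"
    and c: "continuous_map (subtopology cantor_space K) (discrete_topology A) c"
  shows "\<exists>n. \<forall>p\<in>K. \<forall>q\<in>K. agree n p q \<longrightarrow> c p = c q"
proof (rule ccontr)
  assume "\<not> ?thesis"
  then have "\<exists>p. p \<in> K \<and> (\<exists>q\<in>K. agree n p q \<and> c p \<noteq> c q)" for n by blast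
  then obtain z where
    z: "\<And>N. \<exists>n\<ge>N. \<exists>p. (p \<in> K \<and> (\<exists>q\<in>K. agree n p q \<and> c p \<noteq> c q)) \<and> agree N z p"
    using cantor_cluster_point[of "\<lambda>n p. p \<in> K \<and> (\<exists>q\<in>K. agree n p q \<and> c p \<noteq> c q)"] by blast
  have "z \<in> K"
  proof (rule ccontr)
    assume "z \<notin> K"
    moreover have "openin cantor_space (UNIV - K)" using K by (simp add: closedin_def)
    ultimately obtain N where "{q. agree N z q} \<subseteq> UNIV - K"
      unfolding openin_cantor_iff by blast
    then show False using z[of N] by blast
  qed
  then have "c z \<in> A" using c by (auto simp: continuous_map_def)
  then have "openin (subtopology cantor_space K) {p \<in> topspace (subtopology cantor_space K). c p \<in> {c z}}"
    by (intro openin_continuous_map_preimage[OF c]) simp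
  then obtain U where U: "openin cantor_space U" "{p \<in> K. c p = c z} = U \<inter> K"
    by (auto simp: openin_subtopology)
  then have "z \<in> U" using \<open>z \<in> K\<close> by blast
  then obtain N where N: "{q. agree N z q} \<subseteq> U" using U(1) openin_cantor_iff by blast
  obtain n p q where "n \<ge> N" "p \<in> K" "q \<in> K" "agree n p q" "c p \<noteq> c q" "agree N z p"
    using z[of N] by blast
  moreover from this have "agree N z q" using agree_mono agree_trans by blast
  ultimately have "c p = c z" "c q = c z" using N U(2) by blast+
  with \<open>c p \<noteq> c q\<close> show False by simp
qed

lemma zero_DMC_subspace:
  assumes "closedin cantor_space K"
  shows "zero_DMC (subtopology cantor_space K)"
  unfolding zero_DMC_def zero_dimensional_space_def
proof (intro conjI exI ballI)
  let ?X = "subtopology cantor_space K"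
  let ?B = "{K \<inter> {q. agree n p q} | n p. True}"
  show "openin ?X U" "closedin ?X U" if "U \<in> ?B" for U
    using that by (auto intro!: openin_subtopology_Int2 closedin_subtopology_Int_closedin
        openin_cylinder closedin_cylinder)
  show "openin ?X = arbitrary union_of (\<lambda>U. U \<in> ?B)"
  proof
    fix U
    show "openin ?X U = (arbitrary union_of (\<lambda>U. U \<in> ?B)) U"
      unfolding arbitrary_union_of_alt
    proof
      assume "openin ?X U"
      then obtain V where V: "openin cantor_space V" "U = V \<inter> K"
        by (auto simp: openin_subtopology)
      show "\<forall>x\<in>U. \<exists>W. W \<in> ?B \<and> x \<in> W \<and> W \<subseteq> U"
      proof
        fix x assume "x \<in> U"
        then obtain n where "{q. agree n x q} \<subseteq> V" using V openin_cantor_iff by blast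
        then show "\<exists>W. W \<in> ?B \<and> x \<in> W \<and> W \<subseteq> U"
          using \<open>x \<in> U\<close> V(2) by (intro exI[of _ "K \<inter> {q. agree n x q}"]) auto
      qed
    next
      assume "\<forall>x\<in>U. \<exists>W. W \<in> ?B \<and> x \<in> W \<and> W \<subseteq> U"
      moreover have "openin ?X W" if "W \<in> ?B" for W
        using that openin_subtopology_Int2[OF openin_cylinder] by blast
      ultimately show "openin ?X U" by (subst openin_subopen) blast
    qed
  qed
  show "metrizable_space ?X"
    by (simp add: metrizable_space_cantor metrizable_space_subtopology)
  show "compact_space ?X"
    using assms closedin_compact_space compact_space_cantor compact_space_subtopology by blast
qed

lemma zero_dimensional_clopen_neighbourhood:
  assumes "zero_dimensional_space X" "openin X U" "x \<in> U"
  obtains W where "openin X W" "closedin X W" "x \<in> W" "W \<subseteq> U"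
proof -
  obtain \<B> where B: "\<forall>W\<in>\<B>. openin X W \<and> closedin X W"
    "openin X = arbitrary union_of (\<lambda>W. W \<in> \<B>)"
    using assms(1) unfolding zero_dimensional_space_def by blast
  have "(arbitrary union_of (\<lambda>W. W \<in> \<B>)) U" using B(2) assms(2) by metis
  then show thesis
    using B(1) assms(3) that unfolding arbitrary_union_of_alt by metis
qed

text \<open>By compactness, \<open>X\<close> is for each \<open>n\<close> a finite union of clopen sets contained in balls of radius
  \<open>1 / (n + 1)\<close>. These sets, for all \<open>n\<close> together, separate the points.\<close>

lemma zero_DMC_countable_clopen_separation:
  assumes "zero_DMC X"
  obtains W :: "nat \<Rightarrow> 'a set"
  where "\<forall>n. openin X (W n) \<and> closedin X (W n)"
    "\<forall>x\<in>topspace X. \<forall>y\<in>topspace X. x \<noteq> y \<longrightarrow> (\<exists>n. x \<in> W n \<and> y \<notin> W n)"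
proof -
  have zd: "zero_dimensional_space X" and cp: "compact_space X" and mt: "metrizable_space X"
    using assms by (auto simp: zero_DMC_def)
  obtain M d where M: "Metric_space M d" "X = Metric_space.mtopology M d"
    using mt unfolding metrizable_space_def by blast
  interpret Metric_space M d by (rule M(1))
  let ?small = "\<lambda>n W. openin X W \<and> closedin X W \<and> (\<exists>x\<in>M. W \<subseteq> mball x (1 / real (Suc n)))"
  have "\<exists>\<F>. finite \<F> \<and> (\<forall>W\<in>\<F>. ?small n W) \<and> topspace X \<subseteq> \<Union>\<F>" for n
  proof -
    have "\<exists>W. x \<in> W \<and> ?small n W" if "x \<in> topspace X" for x
    proof -
      have "x \<in> M" using that M(2) by simp
      then have "openin X (mball x (1 / real (Suc n)))" "x \<in> mball x (1 / real (Suc n))"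
        using M(2) by auto
      then show ?thesis using zero_dimensional_clopen_neighbourhood[OF zd] \<open>x \<in> M\<close> by metis
    qed
    then have "topspace X \<subseteq> \<Union> {W. ?small n W}" by blast
    moreover have "compactin X (topspace X)" using cp by (simp add: compact_space_def)
    ultimately have "\<exists>\<F>. finite \<F> \<and> \<F> \<subseteq> {W. ?small n W} \<and> topspace X \<subseteq> \<Union>\<F>"
      by (intro compactinD) blast+
    then obtain \<F> where "finite \<F>" "\<F> \<subseteq> {W. ?small n W}" "topspace X \<subseteq> \<Union>\<F>"
      by blast
    then show ?thesis by blast
  qed
  then obtain \<F> where F: "\<And>n. finite (\<F> n)" "\<And>n W. W \<in> \<F> n \<Longrightarrow> ?small n W"
    "\<And>n. topspace X \<subseteq> \<Union> (\<F> n)"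
    by metis
  define \<C> where "\<C> = insert {} (\<Union> (range \<F>))"
  \<comment> \<open>Including the empty set ensures that the family is nonempty and hence the range of a sequence.\<close>
  have "countable \<C>" unfolding \<C>_def using F(1) by (simp add: countable_finite)
  then obtain W :: "nat \<Rightarrow> 'a set" where W: "range W = \<C>"
    using range_from_nat_into[of \<C>] by (metis \<C>_def insert_not_empty)
  have clopen: "openin X U \<and> closedin X U" if "U \<in> \<C>" for U
    using that F(2) by (auto simp: \<C>_def)
  show thesis
  proof (rule that)
    show "\<forall>n. openin X (W n) \<and> closedin X (W n)"
      using clopen W by blast
    show "\<forall>x\<in>topspace X. \<forall>y\<in>topspace X. x \<noteq> y \<longrightarrow> (\<exists>n. x \<in> W n \<and> y \<notin> W n)"
    proof (intro ballI impI)
      fix x y assume xy: "x \<in> topspace X" "y \<in> topspace X" "x \<noteq> y"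
      then have "x \<in> M" "y \<in> M" using M(2) by auto
      then have "0 < d x y" using xy(3) by simp
      then obtain n where n: "inverse (real (Suc n)) < d x y / 2"
        using reals_Archimedean half_gt_zero by blast
      obtain U where U: "U \<in> \<F> n" "x \<in> U" using F(3) xy(1) by blast
      have "y \<notin> U"
      proof
        assume "y \<in> U"
        obtain a where a: "a \<in> M" "U \<subseteq> mball a (1 / real (Suc n))" using F(2) U(1) by blast
        then have "d a x < 1 / real (Suc n)" "d a y < 1 / real (Suc n)"
          using U(2) \<open>y \<in> U\<close> by auto
        moreover have "d x y \<le> d a x + d a y"
          using triangle[OF \<open>x \<in> M\<close> a(1) \<open>y \<in> M\<close>] by (simp add: commute)
        ultimately show False using n by (simp add: inverse_eq_divide)
      qed
      moreover have "U \<in> \<C>" using U(1) by (auto simp: \<C>_def)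
      ultimately show "\<exists>n. x \<in> W n \<and> y \<notin> W n" using W U(2) by (metis imageE)
    qed
  qed
qed

text \<open>A point is sent to the sequence of its memberships in a separating family of clopen sets.\<close>

lemma zero_DMC_imp_inj_into_cantor:
  assumes "zero_DMC X"
  obtains f where "continuous_map X cantor_space f" "inj_on f (topspace X)"
proof -
  obtain W :: "nat \<Rightarrow> 'a set" where clopen: "\<forall>n. openin X (W n) \<and> closedin X (W n)"
    and sep: "\<forall>x\<in>topspace X. \<forall>y\<in>topspace X. x \<noteq> y \<longrightarrow> (\<exists>n. x \<in> W n \<and> y \<notin> W n)"
    by (rule zero_DMC_countable_clopen_separation[OF assms])
  have W: "openin X (W n)" "closedin X (W n)" for n using clopen by auto
  define f where "f = (\<lambda>x n. x \<in> W n)"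
  have "continuous_map X (discrete_topology UNIV) (\<lambda>x. f x n)" for n
    unfolding continuous_map_def
  proof (intro conjI allI impI)
    fix U :: "bool set"
    have "{x \<in> topspace X. f x n \<in> U} =
        (if True \<in> U then W n else {}) \<union> (if False \<in> U then topspace X - W n else {})"
      (is "?L = ?R")
    proof (rule set_eqI)
      fix x show "x \<in> ?L \<longleftrightarrow> x \<in> ?R"
        using openin_subset[OF W(1)[of n]] by (cases "x \<in> W n") (auto simp: f_def)
    qed
    moreover have "openin X (topspace X - W n)" using W(2) by (simp add: closedin_def)
    ultimately show "openin X {x \<in> topspace X. f x n \<in> U}" using W(1) by (auto intro: openin_Un)
  qed simp
  then have "continuous_map X cantor_space f"
    by (simp add: cantor_space_def continuous_map_componentwise_UNIV)
  moreover have "inj_on f (topspace X)"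
    using sep by (auto simp: inj_on_def f_def fun_eq_iff)
  ultimately show thesis by (rule that)
qed

section \<open>Two-colorings\<close>

lemma has_continuous_coloring_mono:
  assumes "has_continuous_coloring X R \<mu>" "\<mu> \<le> \<kappa>"
  shows "has_continuous_coloring X R \<kappa>"
proof -
  obtain c where c: "continuous_map X (discrete_topology {i. enat i < \<mu>}) c" "\<forall>(x, y)\<in>R. c x \<noteq> c y"
    using assms(1) unfolding has_continuous_coloring_def by (elim exE conjE)
  have "id \<in> {i. enat i < \<mu>} \<rightarrow> {i. enat i < \<kappa>}"
    using less_le_trans[OF _ assms(2)] by (simp add: Pi_iff)
  then have "continuous_map (discrete_topology {i. enat i < \<mu>})
      (discrete_topology {i. enat i < \<kappa>}) id"
    by (simp only: continuous_map_from_discrete_topology topspace_discrete_topology)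
  from continuous_map_compose[OF c(1) this]
  have "continuous_map X (discrete_topology {i. enat i < \<kappa>}) c"
    by (simp only: id_comp)
  with c(2) show ?thesis
    unfolding has_continuous_coloring_def by (intro exI[of _ c] conjI)
qed

lemma CCN_le_iff:
  "CCN X R \<le> Countable_card \<kappa> \<longleftrightarrow> has_continuous_coloring X R \<kappa>"
proof
  assume le: "CCN X R \<le> Countable_card \<kappa>"
  have ex: "\<exists>\<kappa>. has_continuous_coloring X R \<kappa>"
  proof (rule ccontr)
    assume "\<not> ?thesis"
    then have "CCN X R = Continuum" unfolding CCN_def by (rule if_not_P)
    then show False using le by simp
  qed
  then have "CCN X R = Countable_card (LEAST \<kappa>. has_continuous_coloring X R \<kappa>)"
    unfolding CCN_def by (rule if_P)
  then have "(LEAST \<kappa>. has_continuous_coloring X R \<kappa>) \<le> \<kappa>"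
    using le by simp
  with LeastI_ex[OF ex] show "has_continuous_coloring X R \<kappa>" by (rule has_continuous_coloring_mono)
next
  assume col: "has_continuous_coloring X R \<kappa>"
  then have "\<exists>\<kappa>. has_continuous_coloring X R \<kappa>" by (rule exI)
  then have "CCN X R = Countable_card (LEAST \<kappa>. has_continuous_coloring X R \<kappa>)"
    unfolding CCN_def by (rule if_P)
  moreover have "(LEAST \<kappa>. has_continuous_coloring X R \<kappa>) \<le> \<kappa>"
    using col by (rule Least_le)
  ultimately show "CCN X R \<le> Countable_card \<kappa>" by simp
qed

text \<open>The values of CCN are cardinals, so that nothing lies strictly between two and three.\<close>

lemma three_le_CCN_iff: "Countable_card 3 \<le> CCN X R \<longleftrightarrow> \<not> CCN X R \<le> Countable_card 2"
proof (cases "CCN X R")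
  case (Countable_card m)
  have "3 \<le> m \<longleftrightarrow> \<not> m \<le> 2"
    by (cases m) (auto simp: numeral_eq_enat)
  then show ?thesis using Countable_card by simp
qed simp

lemma enat_less_two: "enat i < 2 \<longleftrightarrow> i < 2"
  by (simp add: numeral_eq_enat)

lemma has_continuous_coloring_pullback:
  assumes "has_continuous_coloring Y S \<kappa>" "continuous_map X Y \<phi>" "R \<subseteq> map_prod \<phi> \<phi> -` S"
  shows "has_continuous_coloring X R \<kappa>"
proof -
  obtain c where c: "continuous_map Y (discrete_topology {i. enat i < \<kappa>}) c" "\<forall>(x, y)\<in>S. c x \<noteq> c y"
    using assms(1) unfolding has_continuous_coloring_def by (elim exE conjE)
  have "(c \<circ> \<phi>) x \<noteq> (c \<circ> \<phi>) y" if "(x, y) \<in> R" for x y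
  proof -
    have "(\<phi> x, \<phi> y) \<in> S" using that assms(3) by auto
    then show ?thesis using c(2) by auto
  qed
  then show ?thesis
    using continuous_map_compose[OF assms(2) c(1)] unfolding has_continuous_coloring_def
    by (intro exI[of _ "c \<circ> \<phi>"]) auto
qed

lemma sym_relpow: "sym R \<Longrightarrow> (u, v) \<in> R ^^ n \<Longrightarrow> (v, u) \<in> R ^^ n"
proof (induction n arbitrary: v)
  case (Suc n)
  then obtain w where "(u, w) \<in> R ^^ n" "(w, v) \<in> R" by auto
  then have "(v, w) \<in> R" "(w, u) \<in> R ^^ n" using Suc by (auto dest: symD)
  then show ?case by (rule relpow_Suc_I2)
qed auto

text \<open>The walk form of the theorem that a graph without odd cycles is bipartite. A vertex is colored by
  whether it can be reached by an even walk from the representative of its component; two walks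
  of the same parity to adjacent vertices would close up, through the edge, to an odd closed walk.
  A loop is an odd closed walk and thus excluded as well.\<close>

lemma two_coloring_of_no_odd_closed_walk:
  assumes R: "sym R" and odd: "\<And>u m. odd m \<Longrightarrow> (u, u) \<notin> R ^^ m"
  obtains c :: "'b \<Rightarrow> bool" where "\<forall>(u, v)\<in>R. c u \<noteq> c v"
proof -
  define r where "r u = (SOME w. (w, u) \<in> R\<^sup>*)" for u
  define c where "c u \<longleftrightarrow> (\<exists>m. even m \<and> (r u, u) \<in> R ^^ m)" for u
  have "c u \<noteq> c v" if uv: "(u, v) \<in> R" for u v
  proof -
    have "(w, u) \<in> R\<^sup>* \<longleftrightarrow> (w, v) \<in> R\<^sup>*" for w
      using rtrancl_into_rtrancl[of w u R v] rtrancl_into_rtrancl[of w v R u] uv symD[OF R uv]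
      by blast
    then have r: "r u = r v" by (simp add: r_def)
    have path: "\<exists>m. (even m \<longleftrightarrow> c w) \<and> (r w, w) \<in> R ^^ m" for w
    proof (cases "c w")
      case False
      have "(r w, w) \<in> R\<^sup>*" unfolding r_def by (rule someI[of _ w]) simp
      then obtain m where "(r w, w) \<in> R ^^ m" using rtrancl_imp_relpow by blast
      then show ?thesis using False unfolding c_def by blast
    qed (auto simp: c_def)
    obtain m where m: "even m \<longleftrightarrow> c u" "(r u, u) \<in> R ^^ m" using path by blast
    obtain n where n: "even n \<longleftrightarrow> c v" "(r v, v) \<in> R ^^ n" using path by blast
    have "(r u, v) \<in> R ^^ Suc m" using m(2) uv by auto
    moreover have "(v, r u) \<in> R ^^ n" using sym_relpow[OF R n(2)] r by simp
    ultimately have "(r u, r u) \<in> R ^^ (Suc m + n)" unfolding relpow_add by blast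
    then have "even (Suc m + n)" using odd by blast
    then show ?thesis using m(1) n(1) by auto
  qed
  then show thesis by (intro that[of c]) blast
qed

section \<open>The graphs of the family\<close>

lemma two_coloring_of_alternating_walk:
  fixes c :: "'b \<Rightarrow> nat"
  assumes "\<forall>i\<le>n. c (x i) \<noteq> c (y i)" "\<forall>i<n. c (y i) = c (x (Suc i))"
    and "\<forall>i\<le>n. c (x i) < 2 \<and> c (y i) < 2"
  shows "c (y n) = c (x 0) \<longleftrightarrow> odd n"
  using assms
proof (induction n)
  case (Suc n)
  have *: "a \<noteq> b \<Longrightarrow> (b = d) \<noteq> (a = d)" if "a < 2" "b < 2" "d < 2" for a b d :: nat
    using that by linarith
  have "c (y n) = c (x 0) \<longleftrightarrow> odd n"
  proof (rule Suc.IH)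
    show "\<forall>i\<le>n. c (x i) \<noteq> c (y i)" using Suc.prems(1) le_SucI by blast
    show "\<forall>i<n. c (y i) = c (x (Suc i))" using Suc.prems(2) less_SucI by blast
    show "\<forall>i\<le>n. c (x i) < 2 \<and> c (y i) < 2" using Suc.prems(3) le_SucI by blast
  qed
  moreover have "c (y n) \<noteq> c (y (Suc n))" using Suc.prems(1,2) by (metis lessI order_refl)
  moreover have "c (y n) < 2" "c (y (Suc n)) < 2" "c (x 0) < 2" using Suc.prems(3) by auto
  ultimately show ?case using *[of "c (y n)" "c (y (Suc n))" "c (x 0)"] by simp
qed simp

lemma bbG_edge: "i \<le> 2 * k \<Longrightarrow> (fst (\<gamma> k) i, snd (\<gamma> k) i) \<in> bbG \<gamma>"
  unfolding bbG_def symmetrization_def by blast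

lemma sym_bbG: "sym (bbG \<gamma>)"
  unfolding bbG_def symmetrization_def by (rule sym_Un_converse)

text \<open>By symmetry, the projection on the first coordinate contains all end points of edges.\<close>

lemma bbG_subset_bbK: "bbG \<gamma> \<subseteq> bbK \<gamma> \<times> bbK \<gamma>"
proof -
  have "bbG \<gamma> \<subseteq> (fst ` bbG \<gamma>) \<times> (fst ` bbG \<gamma>)"
    using sym_bbG[of \<gamma>] by (force dest: symD)
  moreover have "fst ` bbG \<gamma> \<subseteq> bbK \<gamma>"
    unfolding bbK_def by (rule closure_of_subset) simp
  ultimately show ?thesis by blast
qed

lemma closedin_bbK: "closedin cantor_space (bbK \<gamma>)"
  by (simp add: bbK_def)

lemma graph_on_bbG: "\<gamma> \<in> calI \<Longrightarrow> graph_on (bbK \<gamma>) (bbG \<gamma>)"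
proof -
  assume "\<gamma> \<in> calI"
  then have "fst (\<gamma> k) i \<noteq> snd (\<gamma> k) i" if "i \<le> 2 * k" for k i
    using that unfolding calI_def by blast
  then have "bbG \<gamma> \<inter> Id = {}"
    unfolding bbG_def symmetrization_def by fastforce
  then show ?thesis
    using bbG_subset_bbK sym_bbG by (simp add: graph_on_def digraph_on_def)
qed

lemma countable_bbG: "countable (bbG \<gamma>)"
proof -
  have "{(fst (\<gamma> k) i, snd (\<gamma> k) i) | k i. i \<le> 2 * k}
      \<subseteq> range (\<lambda>(k, i). (fst (\<gamma> k) i, snd (\<gamma> k) i))"
    by auto
  then have "countable {(fst (\<gamma> k) i, snd (\<gamma> k) i) | k i. i \<le> 2 * k}"
    by (rule countable_subset) simp
  moreover have "countable (R\<inverse>)" if "countable R" for R :: "(cantor \<times> cantor) set"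
  proof -
    have "R\<inverse> = prod.swap ` R" by force
    then show ?thesis using that by simp
  qed
  ultimately show ?thesis
    unfolding bbG_def symmetrization_def by (intro countable_Un) simp_all
qed

text \<open>The color is constant along the jumps from one edge to the next once these are small, changes
  along each edge, and is the color of \<open>zeros\<close> at both ends of a walk of high index. The number
  of edges being odd, this is contradictory.\<close>

lemma calI_not_2colorable:
  assumes \<gamma>: "\<gamma> \<in> calI"
  shows "\<not> has_continuous_coloring (bbK_space \<gamma>) (bbG \<gamma>) 2"
proof
  assume "has_continuous_coloring (bbK_space \<gamma>) (bbG \<gamma>) 2"
  then obtain c where c: "continuous_map (bbK_space \<gamma>) (discrete_topology {i. enat i < 2}) c"
    and edges: "\<forall>(p, q)\<in>bbG \<gamma>. c p \<noteq> c q"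
    unfolding has_continuous_coloring_def by (elim exE conjE)
  have edge: "c p \<noteq> c q" if "(p, q) \<in> bbG \<gamma>" for p q using that edges by auto
  have c2: "c p < 2" if "p \<in> bbK \<gamma>" for p
    using that c by (auto simp: continuous_map_def enat_less_two)
  obtain n where n: "\<And>p q. p \<in> bbK \<gamma> \<Longrightarrow> q \<in> bbK \<gamma> \<Longrightarrow> agree n p q \<Longrightarrow> c p = c q"
    using uniform_agree_of_continuous[OF closedin_bbK c] by blast
  obtain \<delta> where \<delta>: "\<delta> \<in> calS"
    "\<And>k i. i < 2 * k \<Longrightarrow> agree (\<delta> k) (snd (\<gamma> k) i) (fst (\<gamma> k) (Suc i))"
    using \<gamma> unfolding calI_def agree_iff_restrict by blast
  have "mono \<delta>" using \<delta>(1) by (auto simp: calS_def intro: incseq_SucI)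
  obtain k0 where k0: "n \<le> \<delta> k0"
    using \<delta>(1) by (auto simp: calS_def bdd_above_def) (meson nle_le)
  have "\<forall>\<^sub>F k in sequentially. agree n zeros (fst (\<gamma> k) 0)"
    "\<forall>\<^sub>F k in sequentially. agree n zeros (snd (\<gamma> k) (2 * k))"
    using \<gamma> unfolding calI_def limitin_cantor_iff by blast+
  with eventually_ge_at_top[of k0]
  have "\<forall>\<^sub>F k in sequentially. k \<ge> k0 \<and> agree n zeros (fst (\<gamma> k) 0) \<and> agree n zeros (snd (\<gamma> k) (2 * k))"
    by eventually_elim simp
  then obtain k where k: "k \<ge> k0" "agree n zeros (fst (\<gamma> k) 0)" "agree n zeros (snd (\<gamma> k) (2 * k))"
    using eventually_happens'[OF sequentially_bot] by blast
  have "n \<le> \<delta> k" using k0 \<open>mono \<delta>\<close> k(1) by (meson monoD order_trans)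
  have K: "fst (\<gamma> k) i \<in> bbK \<gamma>" "snd (\<gamma> k) i \<in> bbK \<gamma>" if "i \<le> 2 * k" for i
    using bbG_edge[of i k \<gamma>] that bbG_subset_bbK by blast+
  have "c (snd (\<gamma> k) (2 * k)) = c (fst (\<gamma> k) 0) \<longleftrightarrow> odd (2 * k)"
  proof (rule two_coloring_of_alternating_walk)
    show "\<forall>i\<le>2 * k. c (fst (\<gamma> k) i) \<noteq> c (snd (\<gamma> k) i)"
      using edge bbG_edge by blast
    show "\<forall>i<2 * k. c (snd (\<gamma> k) i) = c (fst (\<gamma> k) (Suc i))"
    proof (intro allI impI)
      fix i assume "i < 2 * k"
      then show "c (snd (\<gamma> k) i) = c (fst (\<gamma> k) (Suc i))"
        by (intro n K agree_mono[OF \<delta>(2) \<open>n \<le> \<delta> k\<close>]) auto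
    qed
    show "\<forall>i\<le>2 * k. c (fst (\<gamma> k) i) < 2 \<and> c (snd (\<gamma> k) i) < 2"
      using K c2 by blast
  qed
  moreover have "c (snd (\<gamma> k) (2 * k)) = c (fst (\<gamma> k) 0)"
    using k(2,3) by (intro n K) (auto simp: agree_def)
  ultimately show False by simp
qed

lemma bbK_in_frakK:
  assumes "\<gamma> \<in> calI"
  shows "(bbK_space \<gamma>, bbG \<gamma>) \<in> frakK"
  using assms calI_not_2colorable[OF assms] zero_DMC_subspace[OF closedin_bbK]
  by (simp add: frakK_def three_le_CCN_iff CCN_le_iff graph_on_bbG)

section \<open>The family has the size of the continuum\<close>

text \<open>The convergence conditions say nothing about the walk of index \<open>0\<close>, which is a single edge.
  So it can store an arbitrary \<open>x\<close>; its other end only has to differ from \<open>x\<close>. For \<open>k > 0\<close>, all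
  edges join \<open>zeros\<close> to a point that agrees with it up to \<open>k\<close>.\<close>

lemma inj_cantor_to_calI: "\<exists>f :: cantor \<Rightarrow> gamma. inj f \<and> range f \<subseteq> calI"
proof -
  define e :: "nat \<Rightarrow> cantor" where "e k = (\<lambda>i. i = k)" for k
  define f :: "cantor \<Rightarrow> gamma" where
    "f x k = (if k = 0 then (restrict (\<lambda>_. x) {..2 * k}, restrict (\<lambda>_. Not \<circ> x) {..2 * k})
      else (restrict (\<lambda>_. zeros) {..2 * k}, restrict (\<lambda>_. e k) {..2 * k}))" for x k
  have e: "e k \<noteq> zeros" "agree k (e k) zeros" for k
    by (auto simp: e_def zeros_def agree_def fun_eq_iff)
  have "x = y" if "f x = f y" for x y
  proof -
    have "fst (f x 0) 0 = fst (f y 0) 0" using that by simp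
    then show ?thesis by (simp add: f_def)
  qed
  then have "inj f" by (rule injI)
  moreover have "f x \<in> calI" for x
    unfolding calI_def limitin_cantor_iff agree_iff_restrict
  proof (intro CollectI conjI allI impI)
    show "f x k \<in> ({..2 * k} \<rightarrow>\<^sub>E UNIV) \<times> ({..2 * k} \<rightarrow>\<^sub>E UNIV)" for k
      by (simp add: f_def)
    show "\<forall>\<^sub>F k in sequentially. agree n zeros (fst (f x k) 0)" for n
      using eventually_gt_at_top[of 0] by eventually_elim (simp add: f_def)
    show "\<forall>\<^sub>F k in sequentially. agree n zeros (snd (f x k) (2 * k))" for n
      using eventually_gt_at_top[of n]
    proof eventually_elim
      case (elim k)
      then show ?case using agree_mono[OF agree_sym[OF e(2)], of n k] by (simp add: f_def)
    qed
    show "fst (f x k) i \<noteq> snd (f x k) i" if "i \<le> 2 * k" for k i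
      using that e(1) by (auto simp: f_def fun_eq_iff zeros_def)
    have "agree k (snd (f x k) i) (fst (f x k) (Suc i))" if "i < 2 * k" for k i
      using that e(2) by (simp add: f_def)
    moreover have "id \<in> calS"
      by (auto simp: calS_def bdd_above_def not_le)
    ultimately show "\<exists>\<delta>\<in>calS. \<forall>k. \<forall>i<2 * k. agree (\<delta> k) (snd (f x k) i) (fst (f x k) (Suc i))"
      by (intro bexI[of _ id]) auto
  qed
  ultimately show ?thesis by blast
qed

lemma inj_gamma_to_cantor: "\<exists>g :: gamma \<Rightarrow> cantor. inj g"
proof -
  define g :: "gamma \<Rightarrow> cantor" where
    "g \<gamma> n = (case prod_decode n of (b, m) \<Rightarrow> case prod_decode m of (k, l) \<Rightarrow>
       case prod_decode l of (i, j) \<Rightarrow> (if b = 0 then fst (\<gamma> k) i j else snd (\<gamma> k) i j))" for \<gamma> n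
  have g: "g \<gamma> (prod_encode (b, prod_encode (k, prod_encode (i, j))))
      = (if b = 0 then fst (\<gamma> k) i j else snd (\<gamma> k) i j)" for \<gamma> b k i j
    by (simp add: g_def)
  have "\<gamma> = \<gamma>'" if "g \<gamma> = g \<gamma>'" for \<gamma> \<gamma>'
  proof -
    have "fst (\<gamma> k) i j = fst (\<gamma>' k) i j" for k i j
      using g[of \<gamma> 0] g[of \<gamma>' 0] that by simp
    moreover have "snd (\<gamma> k) i j = snd (\<gamma>' k) i j" for k i j
      using g[of \<gamma> 1] g[of \<gamma>' 1] that by simp
    ultimately show ?thesis by (simp add: fun_eq_iff prod_eq_iff)
  qed
  then have "inj g" by (rule injI)
  then show ?thesis by blast
qed

lemma calI_bij_cantor: "\<exists>\<gamma> :: cantor \<Rightarrow> gamma. bij_betw \<gamma> UNIV calI"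
proof -
  obtain f :: "cantor \<Rightarrow> gamma" where "inj f" "range f \<subseteq> calI" using inj_cantor_to_calI by blast
  moreover obtain g :: "gamma \<Rightarrow> cantor" where "inj g" using inj_gamma_to_cantor by blast
  then have "inj_on g calI" "g ` calI \<subseteq> UNIV" by (auto intro: inj_on_subset)
  ultimately show ?thesis by (rule Schroeder_Bernstein)
qed

section \<open>Almost closed odd walks\<close>

text \<open>A sequence of \<open>2 * k + 1\<close> edges \<open>(x i, y i)\<close> that is a walk up to errors invisible in the first
  \<open>n\<close> coordinates, and that in this sense starts and ends at \<open>z\<close>.\<close>

definition odd_walk :: "(cantor \<times> cantor) set \<Rightarrow> cantor \<Rightarrow> nat \<Rightarrow> nat \<Rightarrow> (nat \<Rightarrow> cantor) \<Rightarrow> (nat \<Rightarrow> cantor) \<Rightarrow> bool"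
  where "odd_walk H z n k x y \<longleftrightarrow> (\<forall>i\<le>2 * k. (x i, y i) \<in> H) \<and>
    (\<forall>i<2 * k. agree n (y i) (x (Suc i))) \<and> agree n z (x 0) \<and> agree n z (y (2 * k))"

lemma odd_walk_mono: "odd_walk H z n k x y \<Longrightarrow> m \<le> n \<Longrightarrow> odd_walk H z m k x y"
  unfolding odd_walk_def by (blast intro: agree_mono)

text \<open>The last edge is traversed once more, backwards and then forwards again, without new jumps.\<close>

lemma odd_walk_extend:
  assumes "sym H" "odd_walk H z n k x y"
  shows "\<exists>x y. odd_walk H z n (Suc k) x y"
proof -
  let ?x = "\<lambda>i. if i \<le> 2 * k then x i else if i = Suc (2 * k) then y (2 * k) else x (2 * k)"
  let ?y = "\<lambda>i. if i \<le> 2 * k then y i else if i = Suc (2 * k) then x (2 * k) else y (2 * k)"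
  have e: "(x (2 * k), y (2 * k)) \<in> H" using assms(2) by (simp add: odd_walk_def)
  then have "(y (2 * k), x (2 * k)) \<in> H" using assms(1) by (simp add: symD)
  moreover have "agree n (?y i) (?x (Suc i))" if "i < 2 * Suc k" for i
  proof -
    have "i < 2 * k \<or> i = 2 * k \<or> i = Suc (2 * k)" using that by arith
    then show ?thesis using assms(2) by (elim disjE) (auto simp: odd_walk_def)
  qed
  ultimately have "odd_walk H z n (Suc k) ?x ?y"
    using assms(2) e unfolding odd_walk_def by auto
  then show ?thesis by blast
qed

lemma odd_walk_extend_le:
  assumes "sym H" "\<exists>x y. odd_walk H z n k x y" "k \<le> l"
  shows "\<exists>x y. odd_walk H z n l x y"
  using assms(3,2) by (induction rule: dec_induct) (use odd_walk_extend[OF assms(1)] in blast)+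

text \<open>The colorings in the hypothesis are those of the graph induced on the initial segments of length
  \<open>n\<close>. As none of them is proper, this graph has an odd closed walk, and any choice of preimages of
  its edges is a walk with jumps invisible in the first \<open>n\<close> coordinates.\<close>

lemma exists_almost_closed_odd_walk:
  assumes H: "sym H"
    and no_col: "\<And>c. \<forall>p q. agree n p q \<longrightarrow> c p = c q \<Longrightarrow> \<exists>(p, q)\<in>H. c p = (c q :: bool)"
  shows "\<exists>z k x y. odd_walk H z n k x y"
proof -
  define \<pi> :: "cantor \<Rightarrow> cantor" where "\<pi> p = restrict p {..<n}" for p
  have \<pi>: "\<pi> p = \<pi> q \<longleftrightarrow> agree n p q" for p q
    by (simp add: \<pi>_def agree_iff_restrict)
  define R where "R = map_prod \<pi> \<pi> ` H"
  have R_I: "(\<pi> p, \<pi> q) \<in> R" if "(p, q) \<in> H" for p q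
    unfolding R_def using imageI[OF that, of "map_prod \<pi> \<pi>"] by simp
  have R_E: "\<exists>p q. (p, q) \<in> H \<and> \<pi> p = u \<and> \<pi> q = v" if "(u, v) \<in> R" for u v
    using that unfolding R_def by auto
  have "sym R" using H by (auto simp: R_def sym_def)
  have "\<exists>u m. odd m \<and> (u, u) \<in> R ^^ m"
  proof (rule ccontr)
    assume "\<not> ?thesis"
    then have "\<And>u m. odd m \<Longrightarrow> (u, u) \<notin> R ^^ m" by blast
    then obtain c :: "cantor \<Rightarrow> bool" where c: "\<forall>(u, v)\<in>R. c u \<noteq> c v"
      by (rule two_coloring_of_no_odd_closed_walk[OF \<open>sym R\<close>])
    have "\<exists>(p, q)\<in>H. (c \<circ> \<pi>) p = (c \<circ> \<pi>) q"
    proof (rule no_col, intro allI impI)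
      fix p q assume "agree n p q"
      then have "\<pi> p = \<pi> q" by (simp only: \<pi>)
      then show "(c \<circ> \<pi>) p = (c \<circ> \<pi>) q" by simp
    qed
    then obtain e where "e \<in> H" and e: "case e of (p, q) \<Rightarrow> (c \<circ> \<pi>) p = (c \<circ> \<pi>) q" by (rule bexE)
    obtain p q where pq: "e = (p, q)" by (cases e)
    have "c (\<pi> p) \<noteq> c (\<pi> q)" using bspec[OF c R_I[OF \<open>e \<in> H\<close>[unfolded pq]]] by simp
    moreover have "c (\<pi> p) = c (\<pi> q)" using e by (simp add: pq)
    ultimately show False by contradiction
  qed
  then obtain u m where "odd m" "(u, u) \<in> R ^^ m" by blast
  moreover from \<open>odd m\<close> obtain k where "m = Suc (2 * k)" by (auto elim: oddE)
  ultimately obtain w where w: "w 0 = u" "w (Suc (2 * k)) = u"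
    "\<forall>i < Suc (2 * k). (w i, w (Suc i)) \<in> R"
    unfolding relpow_fun_conv by blast
  have "\<forall>i. \<exists>e. i \<le> 2 * k \<longrightarrow> e \<in> H \<and> \<pi> (fst e) = w i \<and> \<pi> (snd e) = w (Suc i)"
  proof
    fix i
    show "\<exists>e. i \<le> 2 * k \<longrightarrow> e \<in> H \<and> \<pi> (fst e) = w i \<and> \<pi> (snd e) = w (Suc i)"
    proof (cases "i \<le> 2 * k")
      case True
      then have "(w i, w (Suc i)) \<in> R" using w(3) by simp
      then obtain p q where "(p, q) \<in> H" "\<pi> p = w i" "\<pi> q = w (Suc i)" using R_E by blast
      then show ?thesis by (intro exI[of _ "(p, q)"]) simp
    qed simp
  qed
  then obtain e where e: "\<forall>i. i \<le> 2 * k \<longrightarrow> e i \<in> H \<and> \<pi> (fst (e i)) = w i \<and> \<pi> (snd (e i)) = w (Suc i)"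
    by (rule choice[THEN exE])
  have "odd_walk H (fst (e 0)) n k (fst \<circ> e) (snd \<circ> e)"
    unfolding odd_walk_def using e w(1,2) by (simp add: \<pi>[symmetric] Suc_leI)
  then show ?thesis by blast
qed

text \<open>The base point may a priori depend on \<open>n\<close>. A cluster point of these base points works for all
  \<open>n\<close>, since a walk of higher precision whose base point is close to it is also a walk at it.\<close>

lemma odd_walks_at_common_point:
  assumes "\<And>n. \<exists>z k x y. odd_walk H z n k x y"
  shows "\<exists>z. \<forall>n. \<exists>k x y. odd_walk H z n k x y"
proof -
  obtain z where z: "\<And>N. \<exists>n\<ge>N. \<exists>p. (\<exists>k x y. odd_walk H p n k x y) \<and> agree N z p"
    using cantor_cluster_point[of "\<lambda>n p. \<exists>k x y. odd_walk H p n k x y"] assms by blast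
  have "\<exists>k x y. odd_walk H z N k x y" for N
  proof -
    obtain n p k x y where "n \<ge> N" "odd_walk H p n k x y" "agree N z p" using z by blast
    then have "odd_walk H p N k x y" using odd_walk_mono by blast
    then have "odd_walk H z N k x y"
      using \<open>agree N z p\<close> unfolding odd_walk_def by (blast intro: agree_trans)
    then show ?thesis by blast
  qed
  then show ?thesis by blast
qed

text \<open>The walks given for increasing \<open>n\<close> may have arbitrary lengths, while index \<open>k\<close> requires exactly
  \<open>2 * k + 1\<close> edges. For each \<open>k\<close> one takes the best precision that this length allows. By
  \<open>odd_walk_extend_le\<close> it does not decrease with \<open>k\<close>, and it exceeds every \<open>n\<close>, since the walk
  given for \<open>n\<close> can be extended to all greater lengths.\<close>

lemma calI_of_odd_walks:
  assumes H: "sym H" "H \<inter> Id = {}"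
    and walks: "\<And>n. \<exists>k x y. odd_walk H zeros n k x y"
  shows "\<exists>\<gamma>\<in>calI. bbG \<gamma> \<subseteq> H"
proof -
  define P where "P n k \<longleftrightarrow> (\<exists>x y. odd_walk H zeros n k x y)" for n k
  have P_mono: "P m l" if "P n k" "m \<le> n" "k \<le> l" for m n k l
    using that odd_walk_mono odd_walk_extend_le[OF H(1)] unfolding P_def by meson
  obtain p q where pq: "(p, q) \<in> H"
    using walks[of 0] unfolding odd_walk_def by blast
  have "odd_walk H zeros 0 0 (\<lambda>_. p) (\<lambda>_. q)"
    using pq by (simp add: odd_walk_def agree_def)
  then have P0: "P 0 k" for k
    using P_mono[of 0 0 0 k] unfolding P_def by blast
  \<comment> \<open>The bound \<open>n \<le> k\<close> makes the maximum exist; precision \<open>0\<close> is always achieved by repeating one edge.\<close>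
  define \<delta> where "\<delta> k = (GREATEST n. n \<le> k \<and> P n k)" for k
  have \<delta>: "\<delta> k \<le> k \<and> P (\<delta> k) k" for k
    unfolding \<delta>_def by (rule GreatestI_nat[where b = k and k = 0]) (use P0 in auto)
  have \<delta>_max: "n \<le> \<delta> k" if "n \<le> k" "P n k" for n k
    unfolding \<delta>_def by (rule Greatest_le_nat[where b = k]) (use that in auto)
  have "\<delta> k \<le> \<delta> (Suc k)" for k
    using \<delta>[of k] P_mono[of "\<delta> k" k "\<delta> k" "Suc k"] by (intro \<delta>_max) auto
  moreover have unbounded: "\<exists>k. n \<le> \<delta> k" for n
  proof -
    obtain k where "P n k" using walks P_def by blast
    then have "P n (max n k)" using P_mono by auto
    then show ?thesis using \<delta>_max by (metis max.cobounded1)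
  qed
  then have "\<not> bdd_above (range \<delta>)"
    unfolding bdd_above_def by (metis not_less_eq_eq rangeI)
  ultimately have \<delta>_calS: "\<delta> \<in> calS" by (simp add: calS_def)
  have "mono \<delta>" using \<delta>_calS by (auto simp: calS_def intro: incseq_SucI)
  obtain x y where xy: "\<And>k. odd_walk H zeros (\<delta> k) k (x k) (y k)"
    using \<delta> unfolding P_def by metis
  define \<gamma> :: gamma where "\<gamma> k = (restrict (x k) {..2 * k}, restrict (y k) {..2 * k})" for k
  have lim: "\<forall>\<^sub>F k in sequentially. agree n zeros (f k)"
    if "\<And>k. agree (\<delta> k) zeros (f k)" for f n
  proof -
    obtain k0 where k0: "n \<le> \<delta> k0" using unbounded by blast
    show ?thesis
      using eventually_ge_at_top[of k0]
    proof eventually_elim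
      case (elim k)
      then have "n \<le> \<delta> k" using k0 \<open>mono \<delta>\<close> by (meson monoD order_trans)
      then show ?case using that agree_mono by blast
    qed
  qed
  have "\<gamma> \<in> calI"
    unfolding calI_def limitin_cantor_iff agree_iff_restrict
  proof (intro CollectI conjI allI impI)
    show "\<gamma> k \<in> ({..2 * k} \<rightarrow>\<^sub>E UNIV) \<times> ({..2 * k} \<rightarrow>\<^sub>E UNIV)" for k
      by (simp add: \<gamma>_def)
    show "\<forall>\<^sub>F k in sequentially. agree n zeros (fst (\<gamma> k) 0)" for n
      by (rule lim) (use xy in \<open>simp add: \<gamma>_def odd_walk_def\<close>)
    show "\<forall>\<^sub>F k in sequentially. agree n zeros (snd (\<gamma> k) (2 * k))" for n
      by (rule lim) (use xy in \<open>simp add: \<gamma>_def odd_walk_def\<close>)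
    show "fst (\<gamma> k) i \<noteq> snd (\<gamma> k) i" if "i \<le> 2 * k" for k i
    proof -
      have "(x k i, y k i) \<in> H" using xy that unfolding odd_walk_def by blast
      then show ?thesis using that H(2) by (auto simp: \<gamma>_def)
    qed
    show "\<exists>\<delta>\<in>calS. \<forall>k. \<forall>i<2 * k. agree (\<delta> k) (snd (\<gamma> k) i) (fst (\<gamma> k) (Suc i))"
      using \<delta>_calS xy by (intro bexI[of _ \<delta>]) (auto simp: \<gamma>_def odd_walk_def)
  qed
  moreover have "(fst (\<gamma> k) i, snd (\<gamma> k) i) \<in> H" if "i \<le> 2 * k" for k i
    using xy that by (simp add: \<gamma>_def odd_walk_def)
  then have "bbG \<gamma> \<subseteq> H"
    using H(1) by (auto simp: bbG_def symmetrization_def dest: symD)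
  ultimately show ?thesis by blast
qed

section \<open>The dichotomy\<close>

text \<open>Translation by \<open>z\<close> in the group \<open>(\<int>/2)\<^sup>\<omega>\<close>.\<close>

definition shift :: "cantor \<Rightarrow> cantor \<Rightarrow> cantor" where
  "shift z p = (\<lambda>i. p i \<noteq> z i)"

lemma agree_shift [simp]: "agree n (shift z p) (shift z q) \<longleftrightarrow> agree n p q"
  by (auto simp: shift_def agree_def)

lemma shift_self [simp]: "shift z z = zeros"
  by (simp add: shift_def zeros_def)

lemma inj_shift: "inj (shift z)"
  by (auto simp: inj_def shift_def fun_eq_iff)

lemma continuous_map_shift: "continuous_map cantor_space cantor_space (shift z)"
proof (unfold continuous_map_def, intro conjI allI impI)
  fix U assume U: "openin cantor_space U"
  show "openin cantor_space {p \<in> topspace cantor_space. shift z p \<in> U}"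
    unfolding openin_cantor_iff
  proof
    fix p assume "p \<in> {p \<in> topspace cantor_space. shift z p \<in> U}"
    then obtain n where "{q. agree n (shift z p) q} \<subseteq> U" using U openin_cantor_iff by blast
    then show "\<exists>n. {q. agree n p q} \<subseteq> {p \<in> topspace cantor_space. shift z p \<in> U}"
      by (intro exI[of _ n]) auto
  qed
qed simp

lemma odd_walk_shift:
  assumes "odd_walk H z n k x y"
  shows "odd_walk (map_prod (shift z) (shift z) ` H) zeros n k (shift z \<circ> x) (shift z \<circ> y)"
  using assms agree_shift[of n z z] unfolding odd_walk_def
  by (auto intro!: image_eqI[of _ _ "(x _, y _)"])

lemma not_2colorable_imp_odd_walk:
  assumes f: "continuous_map X cantor_space f" and G: "sym G"
    and no_col: "\<not> has_continuous_coloring X G 2"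
  shows "\<exists>z k x y. odd_walk (map_prod f f ` G) z n k x y"
proof (rule exists_almost_closed_odd_walk)
  show "sym (map_prod f f ` G)" using G by (auto simp: sym_def)
  fix c :: "cantor \<Rightarrow> bool" assume c: "\<forall>p q. agree n p q \<longrightarrow> c p = c q"
  have "continuous_map cantor_space (discrete_topology {i. enat i < 2}) (\<lambda>p. of_bool (c p))"
    unfolding continuous_map_def openin_cantor_iff
  proof (intro conjI allI impI ballI)
    show "\<exists>n. {q. agree n p q} \<subseteq> {q \<in> topspace cantor_space. of_bool (c q) \<in> U}"
      if "p \<in> {p \<in> topspace cantor_space. of_bool (c p) \<in> U}" for U :: "nat set" and p
      using that c by (intro exI[of _ n]) auto
  qed (auto simp: enat_less_two)
  from continuous_map_compose[OF f this]
  have col: "has_continuous_coloring X G 2"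
    if "\<forall>(x, y)\<in>G. of_bool (c (f x)) \<noteq> (of_bool (c (f y)) :: nat)"
    unfolding has_continuous_coloring_def
    by (intro exI[of _ "(\<lambda>p. of_bool (c p)) \<circ> f"]) (use that in simp)
  show "\<exists>(p, q)\<in>map_prod f f ` G. c p = c q"
  proof (rule ccontr)
    assume proper: "\<not> ?thesis"
    have "c (f x) \<noteq> c (f y)" if "(x, y) \<in> G" for x y
    proof
      assume "c (f x) = c (f y)"
      then have "case map_prod f f (x, y) of (p, q) \<Rightarrow> c p = c q" by simp
      moreover have "map_prod f f (x, y) \<in> map_prod f f ` G" using that by (rule imageI)
      ultimately have "\<exists>(p, q)\<in>map_prod f f ` G. c p = c q" by (rule bexI)
      with proper show False by contradiction
    qed
    then have "\<forall>(x, y)\<in>G. of_bool (c (f x)) \<noteq> (of_bool (c (f y)) :: nat)"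
      unfolding of_bool_eq_iff by (intro ballI) (simp only: split_paired_all split_conv not_False_eq_True)
    then have "has_continuous_coloring X G 2" by (rule col)
    with no_col show False by contradiction
  qed
qed

text \<open>The injection is the inverse of an embedding \<open>f\<close> of \<open>X\<close> into the Cantor space that sends the
  common base point of the odd walks to \<open>zeros\<close>. It is defined on all of \<open>bbK \<gamma>\<close>, since the image of
  \<open>f\<close> is closed and contains all end points of the edges in \<open>bbG \<gamma>\<close>.\<close>

lemma calI_minorizes:
  assumes X: "zero_DMC X" and G: "graph_on (topspace X) G"
    and no_col: "\<not> has_continuous_coloring X G 2"
  shows "\<exists>\<gamma>\<in>calI. \<exists>\<phi>. continuous_map (bbK_space \<gamma>) X \<phi> \<and> inj_on \<phi> (bbK \<gamma>) \<and>
    bbG \<gamma> \<subseteq> map_prod \<phi> \<phi> -` G"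
proof -
  have G': "G \<subseteq> topspace X \<times> topspace X" "G \<inter> Id = {}" "sym G"
    using G by (auto simp: graph_on_def digraph_on_def)
  obtain f0 where f0: "continuous_map X cantor_space f0" "inj_on f0 (topspace X)"
    by (rule zero_DMC_imp_inj_into_cantor[OF X])
  obtain z where z: "\<And>n. \<exists>k x y. odd_walk (map_prod f0 f0 ` G) z n k x y"
    using odd_walks_at_common_point[OF not_2colorable_imp_odd_walk[OF f0(1) G'(3) no_col]] by blast
  \<comment> \<open>The point \<open>z\<close> is moved to \<open>zeros\<close>, at which the walks of the family accumulate.\<close>
  define f where "f = shift z \<circ> f0"
  have f: "continuous_map X cantor_space f" "inj_on f (topspace X)"
    unfolding f_def using continuous_map_compose[OF f0(1) continuous_map_shift]
      comp_inj_on[OF f0(2) inj_on_subset[OF inj_shift subset_UNIV]] by this+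
  define H where "H = map_prod f f ` G"
  have H_shift: "H = map_prod (shift z) (shift z) ` map_prod f0 f0 ` G"
    unfolding H_def f_def image_image by (intro image_cong) auto
  then have walks: "\<exists>k x y. odd_walk H zeros n k x y" for n
  proof -
    obtain k x y where "odd_walk (map_prod f0 f0 ` G) z n k x y" using z by blast
    then show ?thesis unfolding H_shift by (blast dest: odd_walk_shift)
  qed
  have "sym H" using G'(3) by (auto simp: H_def sym_def)
  moreover have "H \<inter> Id = {}"
  proof -
    have "f x \<noteq> f y" if "(x, y) \<in> G" for x y
    proof -
      have "x \<in> topspace X" "y \<in> topspace X" "x \<noteq> y" using that G'(1,2) by auto
      then show ?thesis using inj_onD[OF f(2)] by blast
    qed
    then show ?thesis by (auto simp: H_def)
  qed
  ultimately have "\<exists>\<gamma>\<in>calI. bbG \<gamma> \<subseteq> H"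
    using walks by (rule calI_of_odd_walks)
  then obtain \<gamma> where \<gamma>: "\<gamma> \<in> calI" "bbG \<gamma> \<subseteq> H"
    by (rule bexE)
  have "compact_space X" using X by (simp add: zero_DMC_def)
  have embedding: "embedding_map X cantor_space f"
    using continuous_imp_embedding_map[OF f(1) \<open>compact_space X\<close> Hausdorff_space_cantor f(2)] .
  have "closed_map X cantor_space f"
    using continuous_imp_closed_map[OF f(1) \<open>compact_space X\<close> Hausdorff_space_cantor] .
  then have closed: "closedin cantor_space (f ` topspace X)"
    unfolding closed_map_def by (meson closedin_topspace)
  obtain g where g: "homeomorphic_maps X (subtopology cantor_space (f ` topspace X)) f g"
    using embedding unfolding embedding_map_def homeomorphic_map_maps by (rule exE)
  have gf: "g (f x) = x" if "x \<in> topspace X" for x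
    using g that by (simp add: homeomorphic_maps_def)
  have "fst ` bbG \<gamma> \<subseteq> f ` topspace X"
    using \<gamma>(2) G'(1) by (fastforce simp: H_def)
  then have K: "bbK \<gamma> \<subseteq> f ` topspace X"
    unfolding bbK_def using closed by (rule closure_of_minimal)
  have "continuous_map (bbK_space \<gamma>) X g"
    using g K continuous_map_from_subtopology_mono unfolding homeomorphic_maps_def by blast
  moreover have "inj_on g (bbK \<gamma>)"
    using K gf by (auto intro!: inj_on_inverseI[of _ f])
  moreover have "bbG \<gamma> \<subseteq> map_prod g g -` G"
    using \<gamma>(2) G'(1) gf by (fastforce simp: H_def)
  ultimately show ?thesis using \<gamma>(1) by blast
qed

theorem theorem1p4:
  shows "(\<exists>\<gamma> :: cantor \<Rightarrow> gamma. bij_betw \<gamma> UNIV calI) \<and>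
    (\<forall>\<gamma> :: cantor \<Rightarrow> gamma. bij_betw \<gamma> UNIV calI \<longrightarrow>
      (\<forall>\<alpha>. compactin cantor_space (bbK (\<gamma> \<alpha>)) \<and>
            graph_on (bbK (\<gamma> \<alpha>)) (bbG (\<gamma> \<alpha>)) \<and> countable (bbG (\<gamma> \<alpha>))) \<and>
      (\<forall>(X :: 'a topology) G. zero_DMC X \<and> graph_on (topspace X) G \<longrightarrow>
        (let one = (CCN X G \<le> Countable_card 2);
             two = (\<exists>\<alpha> \<phi>. continuous_map (bbK_space (\<gamma> \<alpha>)) X \<phi> \<and> inj_on \<phi> (bbK (\<gamma> \<alpha>)) \<and>
                          bbG (\<gamma> \<alpha>) \<subseteq> map_prod \<phi> \<phi> -` G)
         in (one \<or> two) \<and> \<not> (one \<and> two))) \<and>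
      is_basis le_c_inj (range (\<lambda>\<alpha>. (bbK_space (\<gamma> \<alpha>), bbG (\<gamma> \<alpha>)))) frakK
        (frakK :: ('a topology \<times> ('a \<times> 'a) set) set) \<and>
      is_basis le_c (range (\<lambda>\<alpha>. (bbK_space (\<gamma> \<alpha>), bbG (\<gamma> \<alpha>)))) frakK
        (frakK :: ('a topology \<times> ('a \<times> 'a) set) set))"
proof (intro conjI allI impI)
  show "\<exists>\<gamma> :: cantor \<Rightarrow> gamma. bij_betw \<gamma> UNIV calI" by (rule calI_bij_cantor)
next
  fix \<gamma> :: "cantor \<Rightarrow> gamma"
  assume bij: "bij_betw \<gamma> UNIV calI"
  then have mem: "\<gamma> \<alpha> \<in> calI" for \<alpha> by (auto simp: bij_betw_def)
  let ?two = "\<lambda>(X :: 'a topology) G. \<exists>\<alpha> \<phi>. continuous_map (bbK_space (\<gamma> \<alpha>)) X \<phi> \<and>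
    inj_on \<phi> (bbK (\<gamma> \<alpha>)) \<and> bbG (\<gamma> \<alpha>) \<subseteq> map_prod \<phi> \<phi> -` G"
  have below: "?two X G"
    if X: "zero_DMC X" "graph_on (topspace X) G" and ccn: "\<not> CCN X G \<le> Countable_card 2"
    for X :: "'a topology" and G
  proof -
    have "\<not> has_continuous_coloring X G 2" using ccn by (simp add: CCN_le_iff)
    then obtain \<gamma>' \<phi> where \<phi>: "\<gamma>' \<in> calI" "continuous_map (bbK_space \<gamma>') X \<phi>" "inj_on \<phi> (bbK \<gamma>')"
      "bbG \<gamma>' \<subseteq> map_prod \<phi> \<phi> -` G"
      using calI_minorizes[OF X] by blast
    from \<phi>(1) obtain \<alpha> where "\<gamma>' = \<gamma> \<alpha>" using bij unfolding bij_betw_def by blast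
    then show ?thesis using \<phi>(2-) by (intro exI[of _ \<alpha>] exI[of _ \<phi>]) simp
  qed
  show "compactin cantor_space (bbK (\<gamma> \<alpha>))" for \<alpha>
    using closedin_bbK compact_space_cantor closedin_compact_space by blast
  show "graph_on (bbK (\<gamma> \<alpha>)) (bbG (\<gamma> \<alpha>))" for \<alpha>
    using mem by (rule graph_on_bbG)
  show "countable (bbG (\<gamma> \<alpha>))" for \<alpha>
    by (rule countable_bbG)
  show "let one = (CCN X G \<le> Countable_card 2);
             two = (\<exists>\<alpha> \<phi>. continuous_map (bbK_space (\<gamma> \<alpha>)) X \<phi> \<and> inj_on \<phi> (bbK (\<gamma> \<alpha>)) \<and>
                          bbG (\<gamma> \<alpha>) \<subseteq> map_prod \<phi> \<phi> -` G)
         in (one \<or> two) \<and> \<not> (one \<and> two)"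
    if "zero_DMC X \<and> graph_on (topspace X) G" for X :: "'a topology" and G
    unfolding Let_def
  proof (rule conjI)
    have X: "zero_DMC X" "graph_on (topspace X) G" using that by blast+
    show "CCN X G \<le> Countable_card 2 \<or> ?two X G"
      unfolding disj_imp by (intro impI below[OF X])
    show "\<not> (CCN X G \<le> Countable_card 2 \<and> ?two X G)"
    proof (rule notI, elim conjE exE)
      fix \<alpha> \<phi>
      assume "CCN X G \<le> Countable_card 2" "continuous_map (bbK_space (\<gamma> \<alpha>)) X \<phi>"
        "bbG (\<gamma> \<alpha>) \<subseteq> map_prod \<phi> \<phi> -` G"
      then have "has_continuous_coloring (bbK_space (\<gamma> \<alpha>)) (bbG (\<gamma> \<alpha>)) 2"
        unfolding CCN_le_iff by (rule has_continuous_coloring_pullback)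
      then show False using calI_not_2colorable[OF mem] by simp
    qed
  qed
  have "range (\<lambda>\<alpha>. (bbK_space (\<gamma> \<alpha>), bbG (\<gamma> \<alpha>))) \<subseteq> frakK"
    using bbK_in_frakK[OF mem] by blast
  moreover have "\<exists>b\<in>range (\<lambda>\<alpha>. (bbK_space (\<gamma> \<alpha>), bbG (\<gamma> \<alpha>))). le_c_inj b g"
    if "g \<in> frakK" for g :: "'a topology \<times> ('a \<times> 'a) set"
  proof -
    obtain X G where g: "g = (X, G)" by fastforce
    then have "zero_DMC X" "graph_on (topspace X) G" "\<not> CCN X G \<le> Countable_card 2"
      using that by (auto simp: frakK_def three_le_CCN_iff)
    from below[OF this] obtain \<alpha> \<phi> where "continuous_map (bbK_space (\<gamma> \<alpha>)) X \<phi>"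
      "inj_on \<phi> (bbK (\<gamma> \<alpha>))" "bbG (\<gamma> \<alpha>) \<subseteq> map_prod \<phi> \<phi> -` G"
      by (elim exE conjE)
    then have "le_c_inj (bbK_space (\<gamma> \<alpha>), bbG (\<gamma> \<alpha>)) g"
      unfolding g le_c_inj_def by (auto simp: topspace_subtopology)
    then show ?thesis by blast
  qed
  ultimately show inj: "is_basis le_c_inj (range (\<lambda>\<alpha>. (bbK_space (\<gamma> \<alpha>), bbG (\<gamma> \<alpha>)))) frakK
        (frakK :: ('a topology \<times> ('a \<times> 'a) set) set)"
    unfolding is_basis_def by (intro conjI ballI)
  have "le_c_inj b g \<Longrightarrow> le_c b g" for b :: "cantor topology \<times> (cantor \<times> cantor) set"
    and g :: "'a topology \<times> ('a \<times> 'a) set"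
    unfolding le_c_def le_c_inj_def split_beta by (elim exE conjE, intro exI conjI)
  with inj show "is_basis le_c (range (\<lambda>\<alpha>. (bbK_space (\<gamma> \<alpha>), bbG (\<gamma> \<alpha>)))) frakK
        (frakK :: ('a topology \<times> ('a \<times> 'a) set) set)"
    unfolding is_basis_def by blast
qed

end
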